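(* Let $(Q,\cdot,\backslash,/)$ be a middle Bol loop with identity $e$. Then the following hold, where in (a)–(i) the letters denote elements of $Q$. (a) $(yz)^\rho = z^\lambda\cdot y^\rho$ and $z^\rho=z^\lambda$; i.e. $(Q,\cdot)$ is an AAIPL (anti-automorphic inverse property loop). (Write $z^{-1}=z^\rho=z^\lambda$.) (b) $(yx)\backslash x = x\backslash(y\backslash x)$. (c) $(yx)u=x \Leftrightarrow y(xu)=x$; and $R_uL_y=I\Leftrightarrow I=L_yR_u$. (d) $(xz)\backslash x = x\backslash(x/z)$. (e) $(xz)u=x\Leftrightarrow (xu)z=x$; and $R_zR_u=I\Leftrightarrow R_uR_z=I$. (f) $x(z\backslash x)=(x/z)x$. (g) $xx=(x/z)(z^\lambda\backslash x)$ and $xx=(x/y^\rho)(y\backslash x)$. (h) $|x|=2\Leftrightarrow (x/z)^{-1}=z^{-1}\backslash x$. Hence, $(Q,/)\equiv(Q,(\backslash)^* )$. (i) $(x/(yz))x=(x/z)(y\backslash x)$. (j) $(Q,\cdot)$ is a CIPL iff $(Q,\cdot)$ is a commutative WIPL iff $(Q,\cdot)$ is a commutative IPL iff $(Q,\cdot)$ is a commutative LIPL iff $(Q,\cdot)$ is a commutative RIPL. Hence, $(Q,\cdot)$ is a commutative Moufang loop. (k) $(Q,\cdot)$ is a SAIPL iff $(Q,\cdot)$ is flexible. (l) $(Q,\cdot)$ is an AIPL iff $(Q,\cdot)$ is commutative. Hence, $(Q,\cdot)$ is an isostroph of a Bruck loop. (m) The following are equivalent (each identity being required for all $x,y\in Q$):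 1. $(Q,/)\equiv(Q,\backslash)$; 2. $x((yx)\backslash x)=y((yx)\backslash y)$; 3. $(x/(yx))x=y((yx)\backslash y)$; 4. $x((yx)\backslash x)=(y/(yx))y$; 5. $(x/(yx))x=(y/(yx))y$.
   Context: A loop $(Q,\cdot,\backslash,/)$ is a loop $(Q,\cdot)$ with identity $e$, where $x\backslash y$ is the unique $z$ with $x\cdot z=y$ and $x/y$ is the unique $z$ with $z\cdot y=x$. It is a middle Bol loop if $x((yz)\backslash x)=(x/z)(y\backslash x)$ for all $x,y,z$. The left and right inverses $x^\lambda,x^\rho$ are defined by $x^\lambda x=e$, $xx^\rho=e$. Middle Bol loops are power associative, and $|x|$ denotes the order of $x$. Translations act on the right: $yL_x=xy$, $yR_x=yx$, and products of maps are composed left to right; $I$ is the identity map. For two groupoids on $Q$, "$\equiv$" means that their operations coincide; $(\backslash)^*$ is the opposite of $\backslash$: $x(\backslash)^*y=y\backslash x$. Properties (for all $x,y$): - AAIPL (anti-automorphic inverse property loop): $(xy)^\rho=y^\rho x^\rho$ or $(xy)^\lambda=y^\lambda x^\lambda$. - AIPL (automorphic inverse property loop): $(xy)^\rho=x^\rho y^\rho$ or $(xy)^\lambda=x^\lambda y^\lambda$. - SAIPL (semi-automorphic inverse property loop): $((xy)x)^\rho=(x^\rho y^\rho)x^\rho$ or $((xy)x)^\lambda=(x^\lambda y^\lambda)x^\lambda$. - WIPL (weak inverse property loop): $x(yx)^\rho=y^\rho$ or $(xy)^\lambda x=y^\lambda$. - CIPL (cross inverse property loop): $(xy)x^\rho=y$,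 or $x(yx^\rho)=y$, or $x^\lambda(yx)=y$, or $(x^\lambda y)x=y$. - LIPL (left inverse property loop): $x^\lambda(xy)=y$. RIPL (right inverse property loop): $(yx)x^\rho=y$. IPL: both LIPL and RIPL. - Flexible: $(xy)x=x(yx)$. - Moufang: $(xy)(zx)=(x(yz))x$ for all $x,y,z$. A Bruck loop is a (left or right) Bol loop with the automorphic inverse property (right Bol: $((xy)z)y=x((yz)y)$; left Bol: $(x(yx))z=x(y(xz))$). An isostroph of a loop is an isotope of one of its parastrophes (conjugates).
   Formalization: In (h) the equivalence is stated for x ≠ e, since for x = e the right side always holds but |e| = 1; its "Hence (Q,/)≡(Q,(\)* )" is stated under the condition that every x ≠ e has order 2, as it fails in general, e.g. for the group S_3. *)

theory Defs
  imports "HOL-Algebra.Group"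
begin

section \<open>Loops\<close>

text \<open>
  The record type of \<^theory>\<open>HOL-Algebra.Group\<close> supplies the carrier, the product and the
  distinguished element; associativity is only assumed there by the locale \<^locale>\<open>monoid\<close>.
\<close>

definition ldiv :: "('a, 'b) monoid_scheme \<Rightarrow> 'a \<Rightarrow> 'a \<Rightarrow> 'a" (infixl \<open>\<setminus>\<index>\<close> 70)
  where "x \<setminus>\<^bsub>Q\<^esub> y = (THE z. z \<in> carrier Q \<and> x \<otimes>\<^bsub>Q\<^esub> z = y)"

definition rdiv :: "('a, 'b) monoid_scheme \<Rightarrow> 'a \<Rightarrow> 'a \<Rightarrow> 'a" (infixl \<open>\<oslash>\<index>\<close> 70)
  where "x \<oslash>\<^bsub>Q\<^esub> y = (THE z. z \<in> carrier Q \<and> z \<otimes>\<^bsub>Q\<^esub> y = x)"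

definition linv :: "('a, 'b) monoid_scheme \<Rightarrow> 'a \<Rightarrow> 'a" (\<open>_\<^sup>\<lambda>\<index>\<close> [1000] 999)
  where "x\<^sup>\<lambda>\<^bsub>Q\<^esub> = (THE y. y \<in> carrier Q \<and> y \<otimes>\<^bsub>Q\<^esub> x = \<one>\<^bsub>Q\<^esub>)"

definition rinv :: "('a, 'b) monoid_scheme \<Rightarrow> 'a \<Rightarrow> 'a" (\<open>_\<^sup>\<rho>\<index>\<close> [1000] 999)
  where "x\<^sup>\<rho>\<^bsub>Q\<^esub> = (THE y. y \<in> carrier Q \<and> x \<otimes>\<^bsub>Q\<^esub> y = \<one>\<^bsub>Q\<^esub>)"

locale loop =
  fixes Q (structure)
  assumes m_closed: "\<lbrakk>x \<in> carrier Q; y \<in> carrier Q\<rbrakk> \<Longrightarrow> x \<otimes> y \<in> carrier Q"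
    and ldiv_ex1: "\<lbrakk>x \<in> carrier Q; y \<in> carrier Q\<rbrakk> \<Longrightarrow> \<exists>!z. z \<in> carrier Q \<and> x \<otimes> z = y"
    and rdiv_ex1: "\<lbrakk>x \<in> carrier Q; y \<in> carrier Q\<rbrakk> \<Longrightarrow> \<exists>!z. z \<in> carrier Q \<and> z \<otimes> y = x"
    and one_closed: "\<one> \<in> carrier Q"
    and l_one: "x \<in> carrier Q \<Longrightarrow> \<one> \<otimes> x = x"
    and r_one: "x \<in> carrier Q \<Longrightarrow> x \<otimes> \<one> = x"

locale middle_bol_loop = loop +
  assumes middle_bol:
    "\<lbrakk>x \<in> carrier Q; y \<in> carrier Q; z \<in> carrier Q\<rbrakk>
      \<Longrightarrow> x \<otimes> ((y \<otimes> z) \<setminus> x) = (x \<oslash> z) \<otimes> (y \<setminus> x)"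

text \<open>
  The powers \<open>x [^] n\<close> are left-normed; in a power associative loop the bracketing is irrelevant.
  The value \<open>0\<close> stands for infinite order.
\<close>

definition elt_order :: "('a, 'b) monoid_scheme \<Rightarrow> 'a \<Rightarrow> nat"
  where "elt_order Q x =
    (if \<exists>n::nat. 0 < n \<and> x [^]\<^bsub>Q\<^esub> n = \<one>\<^bsub>Q\<^esub>
     then (LEAST n::nat. 0 < n \<and> x [^]\<^bsub>Q\<^esub> n = \<one>\<^bsub>Q\<^esub>) else 0)"


section \<open>Translations\<close>

definition ltrans :: "('a, 'b) monoid_scheme \<Rightarrow> 'a \<Rightarrow> 'a \<Rightarrow> 'a"
  where "ltrans Q x = (\<lambda>y\<in>carrier Q. x \<otimes>\<^bsub>Q\<^esub> y)"

definition rtrans :: "('a, 'b) monoid_scheme \<Rightarrow> 'a \<Rightarrow> 'a \<Rightarrow> 'a"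
  where "rtrans Q x = (\<lambda>y\<in>carrier Q. y \<otimes>\<^bsub>Q\<^esub> x)"

definition id_map :: "('a, 'b) monoid_scheme \<Rightarrow> 'a \<Rightarrow> 'a"
  where "id_map Q = (\<lambda>x\<in>carrier Q. x)"

text \<open>Maps act on the right, so in the product \<open>f \<Zcomp> g\<close> the map \<open>f\<close> is applied first.\<close>

definition trans_prod :: "('a, 'b) monoid_scheme \<Rightarrow> ('a \<Rightarrow> 'a) \<Rightarrow> ('a \<Rightarrow> 'a) \<Rightarrow> 'a \<Rightarrow> 'a"
    (infixl \<open>\<Zcomp>\<index>\<close> 75)
  where "f \<Zcomp>\<^bsub>Q\<^esub> g = compose (carrier Q) g f"


section \<open>Parastrophes and isostrophes\<close>

definition opp :: "('a \<Rightarrow> 'a \<Rightarrow> 'a) \<Rightarrow> 'a \<Rightarrow> 'a \<Rightarrow> 'a"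
  where "opp f x y = f y x"

definition same_operation ::
    "('a, 'b) monoid_scheme \<Rightarrow> ('a \<Rightarrow> 'a \<Rightarrow> 'a) \<Rightarrow> ('a \<Rightarrow> 'a \<Rightarrow> 'a) \<Rightarrow> bool"
  where "same_operation Q f g \<longleftrightarrow> (\<forall>x\<in>carrier Q. \<forall>y\<in>carrier Q. f x y = g x y)"

definition parastrophes :: "('a, 'b) monoid_scheme \<Rightarrow> ('a \<Rightarrow> 'a \<Rightarrow> 'a) set"
  where "parastrophes Q =
    {mult Q, ldiv Q, rdiv Q, opp (mult Q), opp (ldiv Q), opp (rdiv Q)}"

definition isotopic ::
    "'a set \<Rightarrow> ('a \<Rightarrow> 'a \<Rightarrow> 'a) \<Rightarrow> 'b set \<Rightarrow> ('b \<Rightarrow> 'b \<Rightarrow> 'b) \<Rightarrow> bool"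
  where "isotopic A f B g \<longleftrightarrow>
    (\<exists>\<alpha> \<beta> \<gamma>. bij_betw \<alpha> A B \<and> bij_betw \<beta> A B \<and> bij_betw \<gamma> A B \<and>
      (\<forall>x\<in>A. \<forall>y\<in>A. g (\<alpha> x) (\<beta> y) = \<gamma> (f x y)))"

text \<open>\<open>isostroph Q B\<close>: the groupoid \<open>Q\<close> is an isostroph of the loop \<open>B\<close>.\<close>

definition isostroph :: "('a, 'b) monoid_scheme \<Rightarrow> ('c, 'd) monoid_scheme \<Rightarrow> bool"
  where "isostroph Q B \<longleftrightarrow>
    (\<exists>g\<in>parastrophes B. isotopic (carrier Q) (mult Q) (carrier B) g)"


section \<open>Classes of loops\<close>

definition commutative_loop :: "('a, 'b) monoid_scheme \<Rightarrow> bool"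
  where "commutative_loop Q \<longleftrightarrow> loop Q \<and>
    (\<forall>x\<in>carrier Q. \<forall>y\<in>carrier Q. x \<otimes>\<^bsub>Q\<^esub> y = y \<otimes>\<^bsub>Q\<^esub> x)"

definition AAIPL :: "('a, 'b) monoid_scheme \<Rightarrow> bool"
  where "AAIPL Q \<longleftrightarrow> loop Q \<and>
    ((\<forall>x\<in>carrier Q. \<forall>y\<in>carrier Q. (x \<otimes>\<^bsub>Q\<^esub> y)\<^sup>\<rho>\<^bsub>Q\<^esub> = y\<^sup>\<rho>\<^bsub>Q\<^esub> \<otimes>\<^bsub>Q\<^esub> x\<^sup>\<rho>\<^bsub>Q\<^esub>) \<or>
     (\<forall>x\<in>carrier Q. \<forall>y\<in>carrier Q. (x \<otimes>\<^bsub>Q\<^esub> y)\<^sup>\<lambda>\<^bsub>Q\<^esub> = y\<^sup>\<lambda>\<^bsub>Q\<^esub> \<otimes>\<^bsub>Q\<^esub> x\<^sup>\<lambda>\<^bsub>Q\<^esub>))"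

definition AIPL :: "('a, 'b) monoid_scheme \<Rightarrow> bool"
  where "AIPL Q \<longleftrightarrow> loop Q \<and>
    ((\<forall>x\<in>carrier Q. \<forall>y\<in>carrier Q. (x \<otimes>\<^bsub>Q\<^esub> y)\<^sup>\<rho>\<^bsub>Q\<^esub> = x\<^sup>\<rho>\<^bsub>Q\<^esub> \<otimes>\<^bsub>Q\<^esub> y\<^sup>\<rho>\<^bsub>Q\<^esub>) \<or>
     (\<forall>x\<in>carrier Q. \<forall>y\<in>carrier Q. (x \<otimes>\<^bsub>Q\<^esub> y)\<^sup>\<lambda>\<^bsub>Q\<^esub> = x\<^sup>\<lambda>\<^bsub>Q\<^esub> \<otimes>\<^bsub>Q\<^esub> y\<^sup>\<lambda>\<^bsub>Q\<^esub>))"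

definition SAIPL :: "('a, 'b) monoid_scheme \<Rightarrow> bool"
  where "SAIPL Q \<longleftrightarrow> loop Q \<and>
    ((\<forall>x\<in>carrier Q. \<forall>y\<in>carrier Q.
        ((x \<otimes>\<^bsub>Q\<^esub> y) \<otimes>\<^bsub>Q\<^esub> x)\<^sup>\<rho>\<^bsub>Q\<^esub> = (x\<^sup>\<rho>\<^bsub>Q\<^esub> \<otimes>\<^bsub>Q\<^esub> y\<^sup>\<rho>\<^bsub>Q\<^esub>) \<otimes>\<^bsub>Q\<^esub> x\<^sup>\<rho>\<^bsub>Q\<^esub>) \<or>
     (\<forall>x\<in>carrier Q. \<forall>y\<in>carrier Q.
        ((x \<otimes>\<^bsub>Q\<^esub> y) \<otimes>\<^bsub>Q\<^esub> x)\<^sup>\<lambda>\<^bsub>Q\<^esub> = (x\<^sup>\<lambda>\<^bsub>Q\<^esub> \<otimes>\<^bsub>Q\<^esub> y\<^sup>\<lambda>\<^bsub>Q\<^esub>) \<otimes>\<^bsub>Q\<^esub> x\<^sup>\<lambda>\<^bsub>Q\<^esub>))"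

definition WIPL :: "('a, 'b) monoid_scheme \<Rightarrow> bool"
  where "WIPL Q \<longleftrightarrow> loop Q \<and>
    ((\<forall>x\<in>carrier Q. \<forall>y\<in>carrier Q. x \<otimes>\<^bsub>Q\<^esub> (y \<otimes>\<^bsub>Q\<^esub> x)\<^sup>\<rho>\<^bsub>Q\<^esub> = y\<^sup>\<rho>\<^bsub>Q\<^esub>) \<or>
     (\<forall>x\<in>carrier Q. \<forall>y\<in>carrier Q. (x \<otimes>\<^bsub>Q\<^esub> y)\<^sup>\<lambda>\<^bsub>Q\<^esub> \<otimes>\<^bsub>Q\<^esub> x = y\<^sup>\<lambda>\<^bsub>Q\<^esub>))"

definition CIPL :: "('a, 'b) monoid_scheme \<Rightarrow> bool"
  where "CIPL Q \<longleftrightarrow> loop Q \<and>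
    ((\<forall>x\<in>carrier Q. \<forall>y\<in>carrier Q. (x \<otimes>\<^bsub>Q\<^esub> y) \<otimes>\<^bsub>Q\<^esub> x\<^sup>\<rho>\<^bsub>Q\<^esub> = y) \<or>
     (\<forall>x\<in>carrier Q. \<forall>y\<in>carrier Q. x \<otimes>\<^bsub>Q\<^esub> (y \<otimes>\<^bsub>Q\<^esub> x\<^sup>\<rho>\<^bsub>Q\<^esub>) = y) \<or>
     (\<forall>x\<in>carrier Q. \<forall>y\<in>carrier Q. x\<^sup>\<lambda>\<^bsub>Q\<^esub> \<otimes>\<^bsub>Q\<^esub> (y \<otimes>\<^bsub>Q\<^esub> x) = y) \<or>
     (\<forall>x\<in>carrier Q. \<forall>y\<in>carrier Q. (x\<^sup>\<lambda>\<^bsub>Q\<^esub> \<otimes>\<^bsub>Q\<^esub> y) \<otimes>\<^bsub>Q\<^esub> x = y))"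

definition LIPL :: "('a, 'b) monoid_scheme \<Rightarrow> bool"
  where "LIPL Q \<longleftrightarrow> loop Q \<and>
    (\<forall>x\<in>carrier Q. \<forall>y\<in>carrier Q. x\<^sup>\<lambda>\<^bsub>Q\<^esub> \<otimes>\<^bsub>Q\<^esub> (x \<otimes>\<^bsub>Q\<^esub> y) = y)"

definition RIPL :: "('a, 'b) monoid_scheme \<Rightarrow> bool"
  where "RIPL Q \<longleftrightarrow> loop Q \<and>
    (\<forall>x\<in>carrier Q. \<forall>y\<in>carrier Q. (y \<otimes>\<^bsub>Q\<^esub> x) \<otimes>\<^bsub>Q\<^esub> x\<^sup>\<rho>\<^bsub>Q\<^esub> = y)"

definition IPL :: "('a, 'b) monoid_scheme \<Rightarrow> bool"
  where "IPL Q \<longleftrightarrow> LIPL Q \<and> RIPL Q"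

definition flexible_loop :: "('a, 'b) monoid_scheme \<Rightarrow> bool"
  where "flexible_loop Q \<longleftrightarrow> loop Q \<and>
    (\<forall>x\<in>carrier Q. \<forall>y\<in>carrier Q. (x \<otimes>\<^bsub>Q\<^esub> y) \<otimes>\<^bsub>Q\<^esub> x = x \<otimes>\<^bsub>Q\<^esub> (y \<otimes>\<^bsub>Q\<^esub> x))"

definition moufang_loop :: "('a, 'b) monoid_scheme \<Rightarrow> bool"
  where "moufang_loop Q \<longleftrightarrow> loop Q \<and>
    (\<forall>x\<in>carrier Q. \<forall>y\<in>carrier Q. \<forall>z\<in>carrier Q.
      (x \<otimes>\<^bsub>Q\<^esub> y) \<otimes>\<^bsub>Q\<^esub> (z \<otimes>\<^bsub>Q\<^esub> x) = (x \<otimes>\<^bsub>Q\<^esub> (y \<otimes>\<^bsub>Q\<^esub> z)) \<otimes>\<^bsub>Q\<^esub> x)"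

definition right_bol_loop :: "('a, 'b) monoid_scheme \<Rightarrow> bool"
  where "right_bol_loop Q \<longleftrightarrow> loop Q \<and>
    (\<forall>x\<in>carrier Q. \<forall>y\<in>carrier Q. \<forall>z\<in>carrier Q.
      ((x \<otimes>\<^bsub>Q\<^esub> y) \<otimes>\<^bsub>Q\<^esub> z) \<otimes>\<^bsub>Q\<^esub> y = x \<otimes>\<^bsub>Q\<^esub> ((y \<otimes>\<^bsub>Q\<^esub> z) \<otimes>\<^bsub>Q\<^esub> y))"

definition left_bol_loop :: "('a, 'b) monoid_scheme \<Rightarrow> bool"
  where "left_bol_loop Q \<longleftrightarrow> loop Q \<and>
    (\<forall>x\<in>carrier Q. \<forall>y\<in>carrier Q. \<forall>z\<in>carrier Q.
      (x \<otimes>\<^bsub>Q\<^esub> (y \<otimes>\<^bsub>Q\<^esub> x)) \<otimes>\<^bsub>Q\<^esub> z = x \<otimes>\<^bsub>Q\<^esub> (y \<otimes>\<^bsub>Q\<^esub> (x \<otimes>\<^bsub>Q\<^esub> z)))"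

definition bruck_loop :: "('a, 'b) monoid_scheme \<Rightarrow> bool"
  where "bruck_loop Q \<longleftrightarrow> (left_bol_loop Q \<or> right_bol_loop Q) \<and> AIPL Q"

end

theory Submission
  imports Defs
begin

text \<open>
  The elementary items come from substitutions in the middle Bol identity
  \<open>x((yz)\x) = (x/z)(y\x)\<close>, followed by the translation of divisions into products.
  Setting \<open>y = e\<close> gives (f); setting \<open>x = e\<close> makes inversion a two-sided, involutive
  anti-automorphism; setting \<open>z = x\<close> or \<open>y = x\<close> cancels one factor on the right and gives (b) and
  (d), which become (c) and (e) once divisions are unfolded; and setting \<open>yz = e\<close> gives (g), hence
  (h).

  Because inversion is an anti-automorphism, the automorphic inverse property is commutativity and
  the semi-automorphic one is flexibility.  The cross inverse property implies the automorphic one,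
  hence commutativity, and under commutativity the cross, weak, left and right inverse properties
  are all the cancellation \<open>x\<inverse>(xy) = y\<close>.  Both divisions are then products with inverses, which
  turns the middle Bol identity into the Moufang identity.

  The part with more substance is the Bruck loop of (l).  On the carrier of a commutative middle Bol
  loop consider \<open>x \<circ> y = x / y\<inverse>\<close>.  Its right division is \<open>(x, y) \<mapsto> x y\<inverse>\<close>, so the original
  loop is isotopic to a parastrophe of it, and inversion is an automorphism of both.  The middle Bol
  identity says that \<open>M t = x (t \ x)\<close> satisfies \<open>M (yz) = (x/z)(y\x)\<close>; read through \<open>\<circ>\<close> this
  becomes \<open>x \<circ> (w \<circ> u) = M (w\<inverse>) \<circ> (x\<inverse> \<circ> u)\<close>.  Taking \<open>u = x\<close> identifies \<open>M (w\<inverse>)\<close> with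
  \<open>x \<circ> (w \<circ> x)\<close>, and then \<open>u = x \<circ> v\<close> yields the left Bol identity, since
  \<open>x\<inverse> \<circ> (x \<circ> v) = v\<close>.

  Finally (m) holds because (b), (d) and (f) reduce each of the four identities to
  \<open>y \ x = y / x\<close>.
\<close>


section \<open>Divisions and inverses in loops\<close>

context loop
begin

lemma ldiv_props:
  assumes "x \<in> carrier Q" "y \<in> carrier Q"
  shows "x \<setminus> y \<in> carrier Q \<and> x \<otimes> (x \<setminus> y) = y"
  unfolding ldiv_def using theI'[OF ldiv_ex1[OF assms]] .

lemma rdiv_props:
  assumes "x \<in> carrier Q" "y \<in> carrier Q"
  shows "x \<oslash> y \<in> carrier Q \<and> (x \<oslash> y) \<otimes> y = x"
  unfolding rdiv_def using theI'[OF rdiv_ex1[OF assms]] .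

lemma ldiv_closed: "x \<in> carrier Q \<Longrightarrow> y \<in> carrier Q \<Longrightarrow> x \<setminus> y \<in> carrier Q"
  and mult_ldiv: "x \<in> carrier Q \<Longrightarrow> y \<in> carrier Q \<Longrightarrow> x \<otimes> (x \<setminus> y) = y"
  using ldiv_props by auto

lemma rdiv_closed: "x \<in> carrier Q \<Longrightarrow> y \<in> carrier Q \<Longrightarrow> x \<oslash> y \<in> carrier Q"
  and rdiv_mult: "x \<in> carrier Q \<Longrightarrow> y \<in> carrier Q \<Longrightarrow> (x \<oslash> y) \<otimes> y = x"
  using rdiv_props by auto

lemma ldiv_eq_iff:
  assumes "x \<in> carrier Q" "y \<in> carrier Q" "z \<in> carrier Q"
  shows "x \<setminus> y = z \<longleftrightarrow> x \<otimes> z = y"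
  using ldiv_ex1[OF assms(1,2)] ldiv_props[OF assms(1,2)] assms(3) by blast

lemma rdiv_eq_iff:
  assumes "x \<in> carrier Q" "y \<in> carrier Q" "z \<in> carrier Q"
  shows "x \<oslash> y = z \<longleftrightarrow> z \<otimes> y = x"
  using rdiv_ex1[OF assms(1,2)] rdiv_props[OF assms(1,2)] assms(3) by blast

lemma mult_rdiv: "x \<in> carrier Q \<Longrightarrow> y \<in> carrier Q \<Longrightarrow> (x \<otimes> y) \<oslash> y = x"
  by (simp add: rdiv_eq_iff m_closed)

lemma rdiv_self: "x \<in> carrier Q \<Longrightarrow> x \<oslash> x = \<one>"
  and ldiv_self: "x \<in> carrier Q \<Longrightarrow> x \<setminus> x = \<one>"
  and rdiv_one: "x \<in> carrier Q \<Longrightarrow> x \<oslash> \<one> = x"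
  and one_ldiv: "x \<in> carrier Q \<Longrightarrow> \<one> \<setminus> x = x"
  by (simp_all add: ldiv_eq_iff rdiv_eq_iff one_closed l_one r_one)

lemma rinv_eq_ldiv: "x\<^sup>\<rho> = x \<setminus> \<one>"
  by (simp add: rinv_def ldiv_def)

lemma linv_eq_rdiv: "x\<^sup>\<lambda> = \<one> \<oslash> x"
  by (simp add: linv_def rdiv_def)

lemma rinv_closed: "x \<in> carrier Q \<Longrightarrow> x\<^sup>\<rho> \<in> carrier Q"
  and mult_rinv: "x \<in> carrier Q \<Longrightarrow> x \<otimes> x\<^sup>\<rho> = \<one>"
  and linv_mult: "x \<in> carrier Q \<Longrightarrow> x\<^sup>\<lambda> \<otimes> x = \<one>"
  by (simp_all add: rinv_eq_ldiv linv_eq_rdiv ldiv_closed rdiv_closed mult_ldiv rdiv_mult one_closed)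

lemma rinv_eqI: "x \<in> carrier Q \<Longrightarrow> y \<in> carrier Q \<Longrightarrow> x \<otimes> y = \<one> \<Longrightarrow> x\<^sup>\<rho> = y"
  by (simp add: rinv_eq_ldiv ldiv_eq_iff one_closed)

lemma rinv_eq_iff: "x \<in> carrier Q \<Longrightarrow> y \<in> carrier Q \<Longrightarrow> x\<^sup>\<rho> = y \<longleftrightarrow> x \<otimes> y = \<one>"
  by (simp add: rinv_eq_ldiv ldiv_eq_iff one_closed)

lemma elt_order_eq_2_iff:
  assumes x: "x \<in> carrier Q" and ne: "x \<noteq> \<one>"
  shows "elt_order Q x = 2 \<longleftrightarrow> x \<otimes> x = \<one>"
proof -
  let ?P = "\<lambda>n::nat. 0 < n \<and> x [^] n = \<one>"
  have pow1: "x [^] (1::nat) = x" and pow2: "x [^] (2::nat) = x \<otimes> x"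
    using x by (simp_all add: nat_pow_def numeral_2_eq_2 l_one)
  show ?thesis
  proof
    assume "elt_order Q x = 2"
    then have ex: "\<exists>n. ?P n" and least: "(LEAST n. ?P n) = 2"
      by (auto simp: elt_order_def split: if_splits)
    from LeastI_ex[OF ex] show "x \<otimes> x = \<one>"
      unfolding least pow2 by simp
  next
    assume sq: "x \<otimes> x = \<one>"
    then have P2: "?P 2" by (simp add: pow2)
    have "(LEAST n. ?P n) = 2"
    proof (rule Least_equality)
      show "?P 2" by (rule P2)
    next
      fix n assume n: "?P n"
      then have "n \<noteq> 1" using pow1 ne by metis
      with n show "2 \<le> n" by linarith
    qed
    with P2 show "elt_order Q x = 2"
      unfolding elt_order_def by (simp only: if_P[OF exI[of ?P 2]])
  qed
qed

lemma trans_prod_eq_id_iff: "f \<Zcomp> g = id_map Q \<longleftrightarrow> (\<forall>x\<in>carrier Q. g (f x) = x)"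
  unfolding trans_prod_def id_map_def compose_def by (auto simp: fun_eq_iff restrict_def)

end


section \<open>Specialisations of the middle Bol identity\<close>

context middle_bol_loop
begin

text \<open>The case \<open>y = e\<close>.\<close>

lemma mult_ldiv_eq_rdiv_mult:
  assumes "x \<in> carrier Q" "z \<in> carrier Q"
  shows "x \<otimes> (z \<setminus> x) = (x \<oslash> z) \<otimes> x"
  using middle_bol[of x \<one> z] assms by (simp add: one_closed l_one one_ldiv)

lemma rinv_eq_linv: "z \<in> carrier Q \<Longrightarrow> z\<^sup>\<rho> = z\<^sup>\<lambda>"
  using mult_ldiv_eq_rdiv_mult[of \<one> z]
  by (simp add: one_closed l_one r_one rinv_eq_ldiv linv_eq_rdiv ldiv_closed rdiv_closed)

lemma rinv_mult: "z \<in> carrier Q \<Longrightarrow> z\<^sup>\<rho> \<otimes> z = \<one>"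
  by (simp add: rinv_eq_linv linv_mult)

lemma rinv_rinv: "z \<in> carrier Q \<Longrightarrow> (z\<^sup>\<rho>)\<^sup>\<rho> = z"
  by (simp add: rinv_eq_iff rinv_closed rinv_mult)

text \<open>The case \<open>x = e\<close>.\<close>

lemma rinv_prod:
  assumes "y \<in> carrier Q" "z \<in> carrier Q"
  shows "(y \<otimes> z)\<^sup>\<rho> = z\<^sup>\<rho> \<otimes> y\<^sup>\<rho>"
  using middle_bol[of \<one> y z] assms
  by (simp add: one_closed l_one ldiv_closed m_closed rinv_eq_ldiv[symmetric]
      linv_eq_rdiv[symmetric] rinv_closed rinv_eq_linv[symmetric])

lemma AAIPL_middle_bol: "AAIPL Q"
  unfolding AAIPL_def using rinv_prod loop_axioms by blast

text \<open>The case \<open>z = x\<close>.\<close>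

lemma mult_ldiv_self_right:
  assumes "x \<in> carrier Q" "y \<in> carrier Q"
  shows "x \<otimes> ((y \<otimes> x) \<setminus> x) = y \<setminus> x"
  using middle_bol[of x y x] assms by (simp add: rdiv_self l_one ldiv_closed)

text \<open>The case \<open>y = x\<close>.\<close>

lemma mult_ldiv_self_left:
  assumes "x \<in> carrier Q" "z \<in> carrier Q"
  shows "x \<otimes> ((x \<otimes> z) \<setminus> x) = x \<oslash> z"
  using middle_bol[of x x z] assms by (simp add: ldiv_self r_one rdiv_closed)

lemma ldiv_prod_right:
  assumes "x \<in> carrier Q" "y \<in> carrier Q"
  shows "(y \<otimes> x) \<setminus> x = x \<setminus> (y \<setminus> x)"
  using mult_ldiv_self_right[OF assms] assms by (metis ldiv_closed ldiv_eq_iff m_closed)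

lemma ldiv_prod_left:
  assumes "x \<in> carrier Q" "z \<in> carrier Q"
  shows "(x \<otimes> z) \<setminus> x = x \<setminus> (x \<oslash> z)"
  using mult_ldiv_self_left[OF assms] assms by (metis ldiv_closed ldiv_eq_iff m_closed rdiv_closed)

text \<open>Each side of the preceding two division laws names the unique \<open>u\<close> that solves an equation, so
  equality of the two sides means that the equations have the same solution.\<close>

lemma fix_left_right_iff:
  assumes "x \<in> carrier Q" "y \<in> carrier Q" "u \<in> carrier Q"
  shows "(y \<otimes> x) \<otimes> u = x \<longleftrightarrow> y \<otimes> (x \<otimes> u) = x"
  using ldiv_prod_right[OF assms(1,2)] assms
  by (metis ldiv_closed ldiv_eq_iff m_closed)

lemma fix_right_right_iff:
  assumes "x \<in> carrier Q" "z \<in> carrier Q" "u \<in> carrier Q"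
  shows "(x \<otimes> z) \<otimes> u = x \<longleftrightarrow> (x \<otimes> u) \<otimes> z = x"
  using ldiv_prod_left[OF assms(1,2)] assms
  by (metis ldiv_eq_iff rdiv_closed rdiv_eq_iff m_closed)

lemma rtrans_ltrans_eq_id_iff:
  assumes "y \<in> carrier Q" "u \<in> carrier Q"
  shows "rtrans Q u \<Zcomp> ltrans Q y = id_map Q \<longleftrightarrow> id_map Q = ltrans Q y \<Zcomp> rtrans Q u"
proof -
  have "rtrans Q u \<Zcomp> ltrans Q y = id_map Q \<longleftrightarrow> (\<forall>x\<in>carrier Q. y \<otimes> (x \<otimes> u) = x)"
    using assms by (simp add: trans_prod_eq_id_iff rtrans_def ltrans_def m_closed)
  moreover have "ltrans Q y \<Zcomp> rtrans Q u = id_map Q \<longleftrightarrow> (\<forall>x\<in>carrier Q. (y \<otimes> x) \<otimes> u = x)"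
    using assms by (simp add: trans_prod_eq_id_iff rtrans_def ltrans_def m_closed)
  ultimately show ?thesis
    using fix_left_right_iff assms by metis
qed

lemma rtrans_rtrans_eq_id_iff:
  assumes "z \<in> carrier Q" "u \<in> carrier Q"
  shows "rtrans Q z \<Zcomp> rtrans Q u = id_map Q \<longleftrightarrow> rtrans Q u \<Zcomp> rtrans Q z = id_map Q"
proof -
  have "rtrans Q a \<Zcomp> rtrans Q b = id_map Q \<longleftrightarrow> (\<forall>x\<in>carrier Q. (x \<otimes> a) \<otimes> b = x)"
    if "a \<in> carrier Q" "b \<in> carrier Q" for a b
    using that by (simp add: trans_prod_eq_id_iff rtrans_def m_closed)
  then show ?thesis
    using fix_right_right_iff assms by metis
qed

text \<open>The case \<open>yz = e\<close>.\<close>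

lemma square_eq:
  assumes "x \<in> carrier Q" "z \<in> carrier Q"
  shows "x \<otimes> x = (x \<oslash> z) \<otimes> (z\<^sup>\<rho> \<setminus> x)"
  using middle_bol[of x "z\<^sup>\<rho>" z] assms by (simp add: rinv_closed rinv_mult one_ldiv)

lemma square_eq':
  assumes "x \<in> carrier Q" "y \<in> carrier Q"
  shows "x \<otimes> x = (x \<oslash> y\<^sup>\<rho>) \<otimes> (y \<setminus> x)"
  using square_eq[of x "y\<^sup>\<rho>"] assms by (simp add: rinv_closed rinv_rinv)

lemma elt_order_2_iff_rinv_rdiv:
  assumes "x \<in> carrier Q" "z \<in> carrier Q" "x \<noteq> \<one>"
  shows "elt_order Q x = 2 \<longleftrightarrow> (x \<oslash> z)\<^sup>\<rho> = z\<^sup>\<rho> \<setminus> x"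
  using assms
  by (simp add: elt_order_eq_2_iff square_eq[of x z] rinv_eq_iff rdiv_closed ldiv_closed rinv_closed)

text \<open>In exponent 2 every element is its own inverse, so the preceding criterion loses its inverses;
  \<open>x = e\<close>, whose order is 1, is covered by the agreement of left and right inverses.\<close>

lemma rdiv_eq_opp_ldiv_if_exponent_2:
  assumes "\<forall>x\<in>carrier Q. x \<noteq> \<one> \<longrightarrow> elt_order Q x = 2"
  shows "same_operation Q (rdiv Q) (opp (ldiv Q))"
proof -
  have inv: "x\<^sup>\<rho> = x" if x: "x \<in> carrier Q" for x
  proof (cases "x = \<one>")
    case True
    then show ?thesis by (simp add: rinv_eq_iff one_closed l_one)
  next
    case False
    then have "x \<otimes> x = \<one>"
      using assms elt_order_eq_2_iff[OF x False] x by simp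
    then show ?thesis by (rule rinv_eqI[OF x x])
  qed
  have "x \<oslash> z = z \<setminus> x" if x: "x \<in> carrier Q" and z: "z \<in> carrier Q" for x z
  proof (cases "x = \<one>")
    case True
    then show ?thesis using rinv_eq_linv[OF z] by (simp add: rinv_eq_ldiv linv_eq_rdiv)
  next
    case False
    then have "(x \<oslash> z)\<^sup>\<rho> = z\<^sup>\<rho> \<setminus> x"
      using assms elt_order_2_iff_rinv_rdiv[OF x z False] x by simp
    then show ?thesis by (simp add: inv x z rdiv_closed)
  qed
  then show ?thesis by (simp add: same_operation_def opp_def)
qed


lemma rdiv_prod_mult:
  assumes "x \<in> carrier Q" "y \<in> carrier Q" "z \<in> carrier Q"
  shows "(x \<oslash> (y \<otimes> z)) \<otimes> x = (x \<oslash> z) \<otimes> (y \<setminus> x)"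
  using assms by (simp add: middle_bol[symmetric] mult_ldiv_eq_rdiv_mult m_closed)


section \<open>Inverse properties\<close>

lemma commutative_iff: "commutative_loop Q \<longleftrightarrow> (\<forall>x\<in>carrier Q. \<forall>y\<in>carrier Q. x \<otimes> y = y \<otimes> x)"
  using loop_axioms by (simp add: commutative_loop_def)

text \<open>An identity in inverses can be read as an identity in the elements themselves, because every
  element is an inverse.\<close>

lemma ball_rinv_iff: "(\<forall>x\<in>carrier Q. P (x\<^sup>\<rho>)) \<longleftrightarrow> (\<forall>x\<in>carrier Q. P x)"
proof
  assume P: "\<forall>x\<in>carrier Q. P (x\<^sup>\<rho>)"
  show "\<forall>x\<in>carrier Q. P x"
  proof
    fix x assume x: "x \<in> carrier Q"
    then show "P x" using bspec[OF P rinv_closed[OF x]] by (simp add: rinv_rinv)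
  qed
qed (simp add: rinv_closed)

text \<open>The four cross inverse identities pair up by inverting \<open>x\<close>; the two pairs are linked by
  \<open>fix_left_right_iff\<close>.\<close>

lemma CIPL_iff: "CIPL Q \<longleftrightarrow> (\<forall>x\<in>carrier Q. \<forall>y\<in>carrier Q. (x \<otimes> y) \<otimes> x\<^sup>\<rho> = y)"
    (is "_ \<longleftrightarrow> ?C1")
proof -
  let ?C2 = "\<forall>x\<in>carrier Q. \<forall>y\<in>carrier Q. x \<otimes> (y \<otimes> x\<^sup>\<rho>) = y"
  let ?C3 = "\<forall>x\<in>carrier Q. \<forall>y\<in>carrier Q. x\<^sup>\<lambda> \<otimes> (y \<otimes> x) = y"
  let ?C4 = "\<forall>x\<in>carrier Q. \<forall>y\<in>carrier Q. (x\<^sup>\<lambda> \<otimes> y) \<otimes> x = y"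
  have "?C1 \<longleftrightarrow> ?C2"
    by (simp add: fix_left_right_iff rinv_closed)
  moreover have "?C3 \<longleftrightarrow> ?C2"
    using ball_rinv_iff[of "\<lambda>x. \<forall>y\<in>carrier Q. x \<otimes> (y \<otimes> x\<^sup>\<rho>) = y"]
    by (simp add: rinv_rinv rinv_eq_linv[symmetric])
  moreover have "?C4 \<longleftrightarrow> ?C1"
    using ball_rinv_iff[of "\<lambda>x. \<forall>y\<in>carrier Q. (x \<otimes> y) \<otimes> x\<^sup>\<rho> = y"]
    by (simp add: rinv_rinv rinv_eq_linv[symmetric])
  ultimately show ?thesis
    unfolding CIPL_def using loop_axioms by blast
qed

lemma AIPL_iff_commutative: "AIPL Q \<longleftrightarrow> commutative_loop Q"
proof -
  have "(\<forall>x\<in>carrier Q. \<forall>y\<in>carrier Q. (x \<otimes> y)\<^sup>\<lambda> = x\<^sup>\<lambda> \<otimes> y\<^sup>\<lambda>) \<longleftrightarrow>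
      (\<forall>x\<in>carrier Q. \<forall>y\<in>carrier Q. (x \<otimes> y)\<^sup>\<rho> = x\<^sup>\<rho> \<otimes> y\<^sup>\<rho>)"
    by (simp add: rinv_eq_linv m_closed)
  moreover have "(\<forall>x\<in>carrier Q. \<forall>y\<in>carrier Q. (x \<otimes> y)\<^sup>\<rho> = x\<^sup>\<rho> \<otimes> y\<^sup>\<rho>) \<longleftrightarrow>
      (\<forall>x\<in>carrier Q. \<forall>y\<in>carrier Q. y\<^sup>\<rho> \<otimes> x\<^sup>\<rho> = x\<^sup>\<rho> \<otimes> y\<^sup>\<rho>)"
    by (simp add: rinv_prod)
  moreover have "\<dots> \<longleftrightarrow> (\<forall>x\<in>carrier Q. \<forall>y\<in>carrier Q. y \<otimes> x = x \<otimes> y)"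
    using ball_rinv_iff[of "\<lambda>x. \<forall>y\<in>carrier Q. y\<^sup>\<rho> \<otimes> x = x \<otimes> y\<^sup>\<rho>"]
      ball_rinv_iff[of "\<lambda>y. y \<otimes> x = x \<otimes> y" for x] by simp
  ultimately show ?thesis
    unfolding AIPL_def commutative_iff using loop_axioms by (simp add: eq_commute)
qed

text \<open>Inverting \<open>(xy)x\<close> always gives \<open>x\<inverse>(y\<inverse>x\<inverse>)\<close>, so only the bracketing is in question.\<close>

lemma SAIPL_iff_flexible: "SAIPL Q \<longleftrightarrow> flexible_loop Q"
proof -
  have "(\<forall>x\<in>carrier Q. \<forall>y\<in>carrier Q. ((x \<otimes> y) \<otimes> x)\<^sup>\<lambda> = (x\<^sup>\<lambda> \<otimes> y\<^sup>\<lambda>) \<otimes> x\<^sup>\<lambda>) \<longleftrightarrow>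
      (\<forall>x\<in>carrier Q. \<forall>y\<in>carrier Q. ((x \<otimes> y) \<otimes> x)\<^sup>\<rho> = (x\<^sup>\<rho> \<otimes> y\<^sup>\<rho>) \<otimes> x\<^sup>\<rho>)"
    by (simp add: rinv_eq_linv m_closed)
  moreover have "(\<forall>x\<in>carrier Q. \<forall>y\<in>carrier Q. ((x \<otimes> y) \<otimes> x)\<^sup>\<rho> = (x\<^sup>\<rho> \<otimes> y\<^sup>\<rho>) \<otimes> x\<^sup>\<rho>) \<longleftrightarrow>
      (\<forall>x\<in>carrier Q. \<forall>y\<in>carrier Q. x\<^sup>\<rho> \<otimes> (y\<^sup>\<rho> \<otimes> x\<^sup>\<rho>) = (x\<^sup>\<rho> \<otimes> y\<^sup>\<rho>) \<otimes> x\<^sup>\<rho>)"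
    by (simp add: rinv_prod m_closed)
  moreover have "\<dots> \<longleftrightarrow> (\<forall>x\<in>carrier Q. \<forall>y\<in>carrier Q. x \<otimes> (y \<otimes> x) = (x \<otimes> y) \<otimes> x)"
    using ball_rinv_iff[of "\<lambda>x. \<forall>y\<in>carrier Q. x \<otimes> (y\<^sup>\<rho> \<otimes> x) = (x \<otimes> y\<^sup>\<rho>) \<otimes> x"]
      ball_rinv_iff[of "\<lambda>y. x \<otimes> (y \<otimes> x) = (x \<otimes> y) \<otimes> x" for x] by simp
  ultimately show ?thesis
    unfolding SAIPL_def flexible_loop_def using loop_axioms by (simp add: eq_commute)
qed

text \<open>Cancelling \<open>xy\<close> against its inverse gives \<open>y(xy)\<inverse> = x\<inverse>\<close>, and cancelling \<open>y\<close> from this gives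
  the automorphic inverse property.\<close>

lemma CIPL_imp_commutative:
  assumes "CIPL Q"
  shows "commutative_loop Q"
proof -
  have C: "(x \<otimes> y) \<otimes> x\<^sup>\<rho> = y" if "x \<in> carrier Q" "y \<in> carrier Q" for x y
    using assms that by (simp add: CIPL_iff)
  have "(x \<otimes> y)\<^sup>\<rho> = x\<^sup>\<rho> \<otimes> y\<^sup>\<rho>" if x: "x \<in> carrier Q" and y: "y \<in> carrier Q" for x y
  proof -
    have "y \<otimes> (x \<otimes> y)\<^sup>\<rho> = x\<^sup>\<rho>"
      using C[of "x \<otimes> y" "x\<^sup>\<rho>"] C[of x y] x y by (simp add: m_closed rinv_closed)
    then show ?thesis
      using C[of y "(x \<otimes> y)\<^sup>\<rho>"] x y by (simp add: m_closed rinv_closed)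
  qed
  then show ?thesis
    unfolding AIPL_iff_commutative[symmetric] AIPL_def using loop_axioms by blast
qed

text \<open>Under commutativity all inverse properties are forms of one identity.\<close>

lemma commutative_inverse_properties:
  assumes "commutative_loop Q"
  shows "CIPL Q \<longleftrightarrow> LIPL Q" "RIPL Q \<longleftrightarrow> LIPL Q" "WIPL Q \<longleftrightarrow> LIPL Q"
proof -
  have comm: "x \<otimes> y = y \<otimes> x" if "x \<in> carrier Q" "y \<in> carrier Q" for x y
    using assms that by (simp add: commutative_iff)
  have L: "LIPL Q \<longleftrightarrow> (\<forall>x\<in>carrier Q. \<forall>y\<in>carrier Q. x\<^sup>\<rho> \<otimes> (x \<otimes> y) = y)"
    unfolding LIPL_def using loop_axioms by (simp add: rinv_eq_linv)
  have "CIPL Q \<longleftrightarrow> (\<forall>x\<in>carrier Q. \<forall>y\<in>carrier Q. (x \<otimes> y) \<otimes> x\<^sup>\<rho> = y)"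
    by (rule CIPL_iff)
  then show "CIPL Q \<longleftrightarrow> LIPL Q"
    unfolding L by (metis comm m_closed rinv_closed)
  have "RIPL Q \<longleftrightarrow> (\<forall>x\<in>carrier Q. \<forall>y\<in>carrier Q. (y \<otimes> x) \<otimes> x\<^sup>\<rho> = y)"
    unfolding RIPL_def using loop_axioms by simp
  then show "RIPL Q \<longleftrightarrow> LIPL Q"
    unfolding L by (metis comm m_closed rinv_closed)
  have W1: "(\<forall>x\<in>carrier Q. \<forall>y\<in>carrier Q. x \<otimes> (y \<otimes> x)\<^sup>\<rho> = y\<^sup>\<rho>) \<longleftrightarrow> LIPL Q"
  proof -
    have "(\<forall>x\<in>carrier Q. \<forall>y\<in>carrier Q. x \<otimes> (y \<otimes> x)\<^sup>\<rho> = y\<^sup>\<rho>) \<longleftrightarrow>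
        (\<forall>x\<in>carrier Q. \<forall>y\<in>carrier Q. x \<otimes> (x\<^sup>\<rho> \<otimes> y\<^sup>\<rho>) = y\<^sup>\<rho>)"
      by (simp add: rinv_prod)
    also have "\<dots> \<longleftrightarrow> LIPL Q"
      using ball_rinv_iff[of "\<lambda>y. x \<otimes> (x\<^sup>\<rho> \<otimes> y) = y" for x]
        ball_rinv_iff[of "\<lambda>x. \<forall>y\<in>carrier Q. x \<otimes> (x\<^sup>\<rho> \<otimes> y) = y"]
      by (simp add: L rinv_rinv)
    finally show ?thesis .
  qed
  have W2: "(\<forall>x\<in>carrier Q. \<forall>y\<in>carrier Q. (x \<otimes> y)\<^sup>\<lambda> \<otimes> x = y\<^sup>\<lambda>) \<longleftrightarrow>
      (\<forall>x\<in>carrier Q. \<forall>y\<in>carrier Q. x \<otimes> (y \<otimes> x)\<^sup>\<rho> = y\<^sup>\<rho>)"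
  proof (intro ball_cong refl)
    fix x y assume x: "x \<in> carrier Q" and y: "y \<in> carrier Q"
    have "(x \<otimes> y)\<^sup>\<lambda> \<otimes> x = x \<otimes> (y \<otimes> x)\<^sup>\<rho>"
      using comm[of x "(y \<otimes> x)\<^sup>\<rho>"] comm[OF x y] x y
      by (simp add: rinv_eq_linv[symmetric] m_closed rinv_closed)
    then show "((x \<otimes> y)\<^sup>\<lambda> \<otimes> x = y\<^sup>\<lambda>) = (x \<otimes> (y \<otimes> x)\<^sup>\<rho> = y\<^sup>\<rho>)"
      using y by (simp add: rinv_eq_linv)
  qed
  show "WIPL Q \<longleftrightarrow> LIPL Q"
    by (simp add: WIPL_def W2 W1 loop_axioms)
qed

text \<open>With inverses cancelling, \<open>x / z = x z\<inverse>\<close> and \<open>y \ x = y\<inverse> x\<close>, and the middle Bol identity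
  at \<open>y := z\<inverse>\<close> and \<open>z := y\<inverse>\<close> is the Moufang identity up to commuting the outer factor.\<close>

lemma commutative_LIPL_imp_moufang:
  assumes "commutative_loop Q" "LIPL Q"
  shows "moufang_loop Q"
proof -
  have comm: "x \<otimes> y = y \<otimes> x" if "x \<in> carrier Q" "y \<in> carrier Q" for x y
    using assms(1) that by (simp add: commutative_iff)
  have L: "x\<^sup>\<rho> \<otimes> (x \<otimes> y) = y" if "x \<in> carrier Q" "y \<in> carrier Q" for x y
    using assms(2) that by (simp add: LIPL_def rinv_eq_linv)
  have ld: "y\<^sup>\<rho> \<setminus> x = y \<otimes> x" if "x \<in> carrier Q" "y \<in> carrier Q" for x y
    using that L[of y x] by (simp add: ldiv_eq_iff rinv_closed m_closed)
  have rd: "x \<oslash> y\<^sup>\<rho> = x \<otimes> y" if x: "x \<in> carrier Q" and y: "y \<in> carrier Q" for x y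
  proof -
    have "(x \<otimes> y) \<otimes> y\<^sup>\<rho> = x"
      using L[OF y x] comm[OF x y] comm[of "y \<otimes> x" "y\<^sup>\<rho>"] x y by (simp add: m_closed rinv_closed)
    then show ?thesis using x y by (simp add: rdiv_eq_iff rinv_closed m_closed)
  qed
  have "(x \<otimes> y) \<otimes> (z \<otimes> x) = (x \<otimes> (y \<otimes> z)) \<otimes> x"
    if x: "x \<in> carrier Q" and y: "y \<in> carrier Q" and z: "z \<in> carrier Q" for x y z
  proof -
    have "(x \<otimes> y) \<otimes> (z \<otimes> x) = (x \<oslash> y\<^sup>\<rho>) \<otimes> (z\<^sup>\<rho> \<setminus> x)"
      using x y z by (simp add: ld rd)
    also have "\<dots> = x \<otimes> ((z\<^sup>\<rho> \<otimes> y\<^sup>\<rho>) \<setminus> x)"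
      using x y z by (simp add: middle_bol rinv_closed)
    also have "\<dots> = x \<otimes> ((y \<otimes> z) \<otimes> x)"
      using x y z by (simp add: rinv_prod[symmetric] ld m_closed)
    also have "\<dots> = (x \<otimes> (y \<otimes> z)) \<otimes> x"
      using comm[of x "y \<otimes> z"] comm[of x "(y \<otimes> z) \<otimes> x"] x y z by (simp add: m_closed)
    finally show ?thesis .
  qed
  then show ?thesis
    unfolding moufang_loop_def using loop_axioms by blast
qed


section \<open>The Bruck loop of a commutative middle Bol loop\<close>

definition bruck_loop_of :: "'a monoid"
  where "bruck_loop_of = \<lparr>carrier = carrier Q, mult = (\<lambda>x y. x \<oslash> y\<^sup>\<rho>), one = \<one>\<rparr>"

lemma bruck_loop_of_sel:
  "carrier bruck_loop_of = carrier Q"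
  "x \<otimes>\<^bsub>bruck_loop_of\<^esub> y = x \<oslash> y\<^sup>\<rho>"
  "\<one>\<^bsub>bruck_loop_of\<^esub> = \<one>"
  by (simp_all add: bruck_loop_of_def)

lemma loop_bruck_loop_of: "loop bruck_loop_of"
proof (rule loop.intro, unfold bruck_loop_of_sel)
  fix x y assume x: "x \<in> carrier Q" and y: "y \<in> carrier Q"
  show "x \<oslash> y\<^sup>\<rho> \<in> carrier Q"
    using x y by (simp add: rdiv_closed rinv_closed)
  show "\<exists>!z. z \<in> carrier Q \<and> x \<oslash> z\<^sup>\<rho> = y"
  proof (rule ex1I[of _ "(y \<setminus> x)\<^sup>\<rho>"])
    show "(y \<setminus> x)\<^sup>\<rho> \<in> carrier Q \<and> x \<oslash> ((y \<setminus> x)\<^sup>\<rho>)\<^sup>\<rho> = y"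
      using x y by (simp add: rinv_closed rinv_rinv ldiv_closed rdiv_eq_iff mult_ldiv)
    fix z assume z: "z \<in> carrier Q \<and> x \<oslash> z\<^sup>\<rho> = y"
    then have "y \<setminus> x = z\<^sup>\<rho>"
      using x y by (auto simp: ldiv_eq_iff rinv_closed rdiv_closed rdiv_mult)
    then show "z = (y \<setminus> x)\<^sup>\<rho>"
      using z by (simp add: rinv_rinv)
  qed
  show "\<exists>!z. z \<in> carrier Q \<and> z \<oslash> y\<^sup>\<rho> = x"
  proof (rule ex1I[of _ "x \<otimes> y\<^sup>\<rho>"])
    show "x \<otimes> y\<^sup>\<rho> \<in> carrier Q \<and> (x \<otimes> y\<^sup>\<rho>) \<oslash> y\<^sup>\<rho> = x"
      using x y by (simp add: rinv_closed m_closed mult_rdiv)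
    fix z assume "z \<in> carrier Q \<and> z \<oslash> y\<^sup>\<rho> = x"
    then show "z = x \<otimes> y\<^sup>\<rho>"
      using x y by (auto simp: rdiv_mult rinv_closed)
  qed
next
  show "\<one> \<in> carrier Q" by (rule one_closed)
  fix x assume x: "x \<in> carrier Q"
  show "\<one> \<oslash> x\<^sup>\<rho> = x"
    using x by (simp add: rdiv_eq_iff one_closed rinv_closed mult_rinv)
  have "\<one>\<^sup>\<rho> = \<one>" by (simp add: rinv_eq_iff one_closed l_one)
  then show "x \<oslash> \<one>\<^sup>\<rho> = x"
    using x by (simp add: rdiv_one)
qed

lemma rinv_bruck_loop_of:
  assumes x: "x \<in> carrier Q"
  shows "x\<^sup>\<rho>\<^bsub>bruck_loop_of\<^esub> = x\<^sup>\<rho>"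
proof -
  have "x \<oslash> (x\<^sup>\<rho>)\<^sup>\<rho> = \<one>"
    using x by (simp add: rinv_rinv rdiv_self)
  with loop.rinv_eqI[OF loop_bruck_loop_of] show ?thesis
    using x by (simp add: bruck_loop_of_sel rinv_closed)
qed

lemma isostroph_bruck_loop_of: "isostroph Q bruck_loop_of"
proof -
  let ?B = "bruck_loop_of"
  have "rdiv ?B x (y\<^sup>\<rho>) = x \<otimes> y" if x: "x \<in> carrier Q" and y: "y \<in> carrier Q" for x y
    using x y by (simp add: loop.rdiv_eq_iff[OF loop_bruck_loop_of] bruck_loop_of_sel
        rinv_closed m_closed rinv_rinv mult_rdiv)
  moreover have "bij_betw (rinv Q) (carrier Q) (carrier Q)"
    by (rule bij_betw_byWitness[where f' = "rinv Q"]) (auto simp: rinv_rinv rinv_closed)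
  ultimately have "isotopic (carrier Q) (mult Q) (carrier ?B) (rdiv ?B)"
    unfolding isotopic_def bruck_loop_of_sel
    by (intro exI[of _ id] exI[of _ "rinv Q"]) simp
  then show ?thesis
    unfolding isostroph_def parastrophes_def by blast
qed

lemma bruck_bruck_loop_of:
  assumes "commutative_loop Q"
  shows "bruck_loop bruck_loop_of"
proof -
  have comm: "x \<otimes> y = y \<otimes> x" if "x \<in> carrier Q" "y \<in> carrier Q" for x y
    using assms that by (simp add: commutative_iff)
  have inv_rdiv: "(x \<oslash> y)\<^sup>\<rho> = x\<^sup>\<rho> \<oslash> y\<^sup>\<rho>" if x: "x \<in> carrier Q" and y: "y \<in> carrier Q" for x y
  proof -
    have "(x \<oslash> y)\<^sup>\<rho> \<otimes> y\<^sup>\<rho> = y\<^sup>\<rho> \<otimes> (x \<oslash> y)\<^sup>\<rho>"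
      using x y by (intro comm) (simp_all add: rinv_closed rdiv_closed)
    also have "\<dots> = x\<^sup>\<rho>"
      using x y by (simp add: rinv_prod[symmetric] rdiv_closed rdiv_mult)
    finally show ?thesis
      using x y rdiv_eq_iff[of "x\<^sup>\<rho>" "y\<^sup>\<rho>" "(x \<oslash> y)\<^sup>\<rho>"] by (simp add: rinv_closed rdiv_closed)
  qed
  have rdiv_rdiv: "x \<oslash> (x \<oslash> y) = y" if x: "x \<in> carrier Q" and y: "y \<in> carrier Q" for x y
    using x y comm[of y "x \<oslash> y"] by (simp add: rdiv_eq_iff rdiv_closed rdiv_mult)
  \<comment> \<open>The middle Bol identity in terms of \<open>\<circ>\<close>: the arguments are chosen so that their product is
    \<open>w\<inverse>\<close> and one of the divisions is \<open>x \<circ> (w \<circ> u)\<close>.\<close>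
  have transl: "x \<oslash> (w \<oslash> u\<^sup>\<rho>)\<^sup>\<rho> = (x \<otimes> (w\<^sup>\<rho> \<setminus> x)) \<oslash> (x \<oslash> u)"
    if x: "x \<in> carrier Q" and w: "w \<in> carrier Q" and u: "u \<in> carrier Q" for x w u
  proof -
    define z where "z = w\<^sup>\<rho> \<oslash> u"
    have z: "z \<in> carrier Q" and uz: "u \<otimes> z = w\<^sup>\<rho>"
      using w u comm[of u z] by (simp_all add: z_def rdiv_closed rinv_closed rdiv_mult)
    have ux: "u \<setminus> x = x \<oslash> u"
      using x u comm[of u "x \<oslash> u"] by (simp add: ldiv_eq_iff rdiv_closed rdiv_mult)
    have "x \<otimes> (w\<^sup>\<rho> \<setminus> x) = (x \<oslash> z) \<otimes> (x \<oslash> u)"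
      using middle_bol[OF x u z] by (simp add: uz ux)
    then have "(x \<otimes> (w\<^sup>\<rho> \<setminus> x)) \<oslash> (x \<oslash> u) = x \<oslash> z"
      using x z u by (simp add: mult_rdiv rdiv_closed)
    then show ?thesis
      using w u by (simp add: z_def inv_rdiv rinv_closed rinv_rinv)
  qed
  have bol: "(x \<oslash> (y \<oslash> x\<^sup>\<rho>)\<^sup>\<rho>) \<oslash> z\<^sup>\<rho> = x \<oslash> (y \<oslash> (x \<oslash> z\<^sup>\<rho>)\<^sup>\<rho>)\<^sup>\<rho>"
    if x: "x \<in> carrier Q" and y: "y \<in> carrier Q" and z: "z \<in> carrier Q" for x y z
  proof -
    have "x \<oslash> (y \<oslash> x\<^sup>\<rho>)\<^sup>\<rho> = x \<otimes> (y\<^sup>\<rho> \<setminus> x)"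
      using x y by (simp add: transl rdiv_self rdiv_one ldiv_closed rinv_closed m_closed)
    moreover have "x \<oslash> (y \<oslash> (x \<oslash> z\<^sup>\<rho>)\<^sup>\<rho>)\<^sup>\<rho> = (x \<otimes> (y\<^sup>\<rho> \<setminus> x)) \<oslash> z\<^sup>\<rho>"
      using transl[of x y "x \<oslash> z\<^sup>\<rho>"] x y z by (simp add: rdiv_closed rinv_closed rdiv_rdiv)
    ultimately show ?thesis by simp
  qed
  have "left_bol_loop bruck_loop_of"
    unfolding left_bol_loop_def bruck_loop_of_sel using loop_bruck_loop_of bol by blast
  moreover have "AIPL bruck_loop_of"
    unfolding AIPL_def bruck_loop_of_sel using loop_bruck_loop_of
    by (simp add: rinv_bruck_loop_of rdiv_closed rinv_closed inv_rdiv)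
  ultimately show ?thesis
    by (simp add: bruck_loop_def)
qed


section \<open>Coincidence of the two divisions\<close>

text \<open>By the cases \<open>z = x\<close> and \<open>y = x\<close> of the middle Bol identity, the two sides are \<open>y \ x\<close> and
  \<open>y / x\<close>.\<close>

lemma same_division_iff:
  "same_operation Q (rdiv Q) (ldiv Q) \<longleftrightarrow>
    (\<forall>x\<in>carrier Q. \<forall>y\<in>carrier Q. x \<otimes> ((y \<otimes> x) \<setminus> x) = y \<otimes> ((y \<otimes> x) \<setminus> y))"
  by (auto simp: same_operation_def mult_ldiv_self_right mult_ldiv_self_left)

end


section \<open>Properties of middle Bol loops\<close>

theorem lemma2p1:
  fixes Q :: "('a, 'b) monoid_scheme" (structure)
  assumes "middle_bol_loop Q"
  shows
    \<comment> \<open>(a)\<close>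
    "((\<forall>y\<in>carrier Q. \<forall>z\<in>carrier Q. (y \<otimes> z)\<^sup>\<rho> = z\<^sup>\<lambda> \<otimes> y\<^sup>\<rho>) \<and>
      (\<forall>z\<in>carrier Q. z\<^sup>\<rho> = z\<^sup>\<lambda>) \<and>
      AAIPL Q) \<and>
     \<comment> \<open>(b)\<close>
     (\<forall>x\<in>carrier Q. \<forall>y\<in>carrier Q. (y \<otimes> x) \<setminus> x = x \<setminus> (y \<setminus> x)) \<and>
     \<comment> \<open>(c)\<close>
     ((\<forall>x\<in>carrier Q. \<forall>y\<in>carrier Q. \<forall>u\<in>carrier Q.
         (y \<otimes> x) \<otimes> u = x \<longleftrightarrow> y \<otimes> (x \<otimes> u) = x) \<and>
      (\<forall>y\<in>carrier Q. \<forall>u\<in>carrier Q.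
         rtrans Q u \<Zcomp> ltrans Q y = id_map Q \<longleftrightarrow> id_map Q = ltrans Q y \<Zcomp> rtrans Q u)) \<and>
     \<comment> \<open>(d)\<close>
     (\<forall>x\<in>carrier Q. \<forall>z\<in>carrier Q. (x \<otimes> z) \<setminus> x = x \<setminus> (x \<oslash> z)) \<and>
     \<comment> \<open>(e)\<close>
     ((\<forall>x\<in>carrier Q. \<forall>z\<in>carrier Q. \<forall>u\<in>carrier Q.
         (x \<otimes> z) \<otimes> u = x \<longleftrightarrow> (x \<otimes> u) \<otimes> z = x) \<and>
      (\<forall>z\<in>carrier Q. \<forall>u\<in>carrier Q.
         rtrans Q z \<Zcomp> rtrans Q u = id_map Q \<longleftrightarrow> rtrans Q u \<Zcomp> rtrans Q z = id_map Q)) \<and>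
     \<comment> \<open>(f)\<close>
     (\<forall>x\<in>carrier Q. \<forall>z\<in>carrier Q. x \<otimes> (z \<setminus> x) = (x \<oslash> z) \<otimes> x) \<and>
     \<comment> \<open>(g)\<close>
     ((\<forall>x\<in>carrier Q. \<forall>z\<in>carrier Q. x \<otimes> x = (x \<oslash> z) \<otimes> (z\<^sup>\<lambda> \<setminus> x)) \<and>
      (\<forall>x\<in>carrier Q. \<forall>y\<in>carrier Q. x \<otimes> x = (x \<oslash> y\<^sup>\<rho>) \<otimes> (y \<setminus> x))) \<and>
     \<comment> \<open>(h)\<close>
     ((\<forall>x\<in>carrier Q. \<forall>z\<in>carrier Q.
         x \<noteq> \<one> \<longrightarrow> (elt_order Q x = 2 \<longleftrightarrow> (x \<oslash> z)\<^sup>\<rho> = z\<^sup>\<rho> \<setminus> x)) \<and>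
      ((\<forall>x\<in>carrier Q. x \<noteq> \<one> \<longrightarrow> elt_order Q x = 2) \<longrightarrow>
         same_operation Q (rdiv Q) (opp (ldiv Q)))) \<and>
     \<comment> \<open>(i)\<close>
     (\<forall>x\<in>carrier Q. \<forall>y\<in>carrier Q. \<forall>z\<in>carrier Q.
        (x \<oslash> (y \<otimes> z)) \<otimes> x = (x \<oslash> z) \<otimes> (y \<setminus> x)) \<and>
     \<comment> \<open>(j)\<close>
     ((CIPL Q \<longleftrightarrow> commutative_loop Q \<and> WIPL Q) \<and>
      (commutative_loop Q \<and> WIPL Q \<longleftrightarrow> commutative_loop Q \<and> IPL Q) \<and>
      (commutative_loop Q \<and> IPL Q \<longleftrightarrow> commutative_loop Q \<and> LIPL Q) \<and>
      (commutative_loop Q \<and> LIPL Q \<longleftrightarrow> commutative_loop Q \<and> RIPL Q) \<and>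
      (CIPL Q \<longrightarrow> commutative_loop Q \<and> moufang_loop Q)) \<and>
     \<comment> \<open>(k)\<close>
     (SAIPL Q \<longleftrightarrow> flexible_loop Q) \<and>
     \<comment> \<open>(l)\<close>
     ((AIPL Q \<longleftrightarrow> commutative_loop Q) \<and>
      (AIPL Q \<longrightarrow> (\<exists>B :: 'a monoid. bruck_loop B \<and> isostroph Q B))) \<and>
     \<comment> \<open>(m)\<close>
     ((same_operation Q (rdiv Q) (ldiv Q) \<longleftrightarrow>
        (\<forall>x\<in>carrier Q. \<forall>y\<in>carrier Q.
           x \<otimes> ((y \<otimes> x) \<setminus> x) = y \<otimes> ((y \<otimes> x) \<setminus> y))) \<and>
      (same_operation Q (rdiv Q) (ldiv Q) \<longleftrightarrow>
        (\<forall>x\<in>carrier Q. \<forall>y\<in>carrier Q.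
           (x \<oslash> (y \<otimes> x)) \<otimes> x = y \<otimes> ((y \<otimes> x) \<setminus> y))) \<and>
      (same_operation Q (rdiv Q) (ldiv Q) \<longleftrightarrow>
        (\<forall>x\<in>carrier Q. \<forall>y\<in>carrier Q.
           x \<otimes> ((y \<otimes> x) \<setminus> x) = (y \<oslash> (y \<otimes> x)) \<otimes> y)) \<and>
      (same_operation Q (rdiv Q) (ldiv Q) \<longleftrightarrow>
        (\<forall>x\<in>carrier Q. \<forall>y\<in>carrier Q.
           (x \<oslash> (y \<otimes> x)) \<otimes> x = (y \<oslash> (y \<otimes> x)) \<otimes> y)))"
proof -
  interpret middle_bol_loop Q by fact
  \<comment> \<open>The four identities of (m) differ only by the case \<open>y = e\<close> of the middle Bol identity.\<close>
  have fold: "(x \<oslash> (y \<otimes> x)) \<otimes> x = x \<otimes> ((y \<otimes> x) \<setminus> x)"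
      "(y \<oslash> (y \<otimes> x)) \<otimes> y = y \<otimes> ((y \<otimes> x) \<setminus> y)"
    if "x \<in> carrier Q" "y \<in> carrier Q" for x y
    using that by (simp_all add: mult_ldiv_eq_rdiv_mult m_closed)
  have j: "CIPL Q \<longleftrightarrow> commutative_loop Q \<and> LIPL Q"
    "commutative_loop Q \<and> WIPL Q \<longleftrightarrow> commutative_loop Q \<and> LIPL Q"
    "commutative_loop Q \<and> RIPL Q \<longleftrightarrow> commutative_loop Q \<and> LIPL Q"
    "commutative_loop Q \<and> IPL Q \<longleftrightarrow> commutative_loop Q \<and> LIPL Q"
    using CIPL_imp_commutative commutative_inverse_properties by (auto simp: IPL_def)
  have l: "\<exists>B :: 'a monoid. bruck_loop B \<and> isostroph Q B" if "AIPL Q"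
    using that AIPL_iff_commutative bruck_bruck_loop_of isostroph_bruck_loop_of by blast
  show ?thesis
  proof (intro conjI)
    show "\<forall>y\<in>carrier Q. \<forall>z\<in>carrier Q. (y \<otimes> z)\<^sup>\<rho> = z\<^sup>\<lambda> \<otimes> y\<^sup>\<rho>"
      by (simp add: rinv_prod rinv_eq_linv)
    show "\<forall>x\<in>carrier Q. \<forall>z\<in>carrier Q. x \<otimes> x = (x \<oslash> z) \<otimes> (z\<^sup>\<lambda> \<setminus> x)"
      by (simp add: square_eq rinv_eq_linv)
    show "same_operation Q (rdiv Q) (ldiv Q) \<longleftrightarrow> (\<forall>x\<in>carrier Q. \<forall>y\<in>carrier Q.
        (x \<oslash> (y \<otimes> x)) \<otimes> x = y \<otimes> ((y \<otimes> x) \<setminus> y))"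
      "same_operation Q (rdiv Q) (ldiv Q) \<longleftrightarrow> (\<forall>x\<in>carrier Q. \<forall>y\<in>carrier Q.
        x \<otimes> ((y \<otimes> x) \<setminus> x) = (y \<oslash> (y \<otimes> x)) \<otimes> y)"
      "same_operation Q (rdiv Q) (ldiv Q) \<longleftrightarrow> (\<forall>x\<in>carrier Q. \<forall>y\<in>carrier Q.
        (x \<oslash> (y \<otimes> x)) \<otimes> x = (y \<oslash> (y \<otimes> x)) \<otimes> y)"
      by (simp_all add: same_division_iff fold)
    show "CIPL Q \<longrightarrow> commutative_loop Q \<and> moufang_loop Q"
      using commutative_LIPL_imp_moufang by (simp add: j)
    show "AIPL Q \<longrightarrow> (\<exists>B :: 'a monoid. bruck_loop B \<and> isostroph Q B)"
      using l by blast
    show "(\<forall>x\<in>carrier Q. x \<noteq> \<one> \<longrightarrow> elt_order Q x = 2) \<longrightarrow>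
        same_operation Q (rdiv Q) (opp (ldiv Q))"
      using rdiv_eq_opp_ldiv_if_exponent_2 by blast
  qed (simp_all only: j SAIPL_iff_flexible AIPL_iff_commutative AAIPL_middle_bol,
      (intro ballI impI rinv_eq_linv ldiv_prod_right fix_left_right_iff rtrans_ltrans_eq_id_iff
        ldiv_prod_left fix_right_right_iff rtrans_rtrans_eq_id_iff mult_ldiv_eq_rdiv_mult
        square_eq' elt_order_2_iff_rinv_rdiv rdiv_prod_mult same_division_iff; assumption)+)
qed

end
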